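(* (The Lying-Over Theorem on left commutative rngs.) Let $U$ be a left commutative rng with fixed left identity $1^{\ell}$, let $R$ be a left commutative subrng of $U$, and suppose that $U$ is graded integral over $R$. If $p$ is a Hu-Liu prime ideal of $R$, then there exists a Hu-Liu prime ideal $q$ of $U$ such that $q\cap R=p$.
   Context: Conventions. A "ring" is an associative ring with an identity; a "rng" is an associative ring (additive abelian group with associative, distributive product) that does not have a two-sided identity. Left commutative rng. A rng $(R,+,\cdot)$ (write $xy$ for $x\cdot y$) is called a left commutative rng if: (i) $xyz=yxz$ for all $x,y,z\in R$; (ii) there is a left identity $1^{\ell}\in R$, i.e. $1^{\ell}x=x$ for all $x\in R$; (iii) on the additive halo $\hbar^+(R):=\{x\in R \mid x1^{\ell}=0\}$ there is a binary operation $\sharp$ (the local product) such that $(\hbar^+(R),+,\sharp)$ is a commutative ring with an identity $1^{\sharp}$; (iv) $(x\alpha)\,\sharp\,\beta=x(\alpha\,\sharp\,\beta)$ for all $x\in R$ and $\alpha,\beta\in\hbar^+(R)$. The local product $\sharp$ is part of the structure. A left commutative rng may have several left identities; one left identity $1^{\ell}$ is fixed throughout and all notions below refer to it. Grading. For a left commutative rng $R$ put $R_0:=R1^{\ell}$ and $R_1:=\hbar^+(R)$. Then $R=R_0\oplus R_1$ as abelian groups, and each $a\in R$ is uniquely $a=a_0+a_1$ with $a_0:=a1^{\ell}\in R_0$ and $a_1:=a-a1^{\ell}\in R_1$; $a_\varepsilon$ is the $\varepsilon$-component of $a$ ($\varepsilon=0,1$). $R_0$ is regarded as a commutative ring under $\cdot$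 with identity $1^{\ell}$, and $R_1$ as a commutative ring under $\sharp$ with identity $1^{\sharp}$. Ideals. An additive subgroup $I$ of $R$ is an ideal of $R$ if $IR\subseteq I$, $RI\subseteq I$, and $I\cap\hbar^+(R)$ is an ideal of the ring $(\hbar^+(R),+,\sharp)$. Any ideal satisfies $I=I_0\oplus I_1$ with $I_\varepsilon:=I\cap R_\varepsilon$. Left commutative subrngs. An additive subgroup $R$ of a left commutative rng $U$ is a left commutative subrng of $U$ if $1^{\ell}\in R$, $RR\subseteq R$, and $R\cap\hbar^+(U)$ is a subring of the ring $(\hbar^+(U),+,\sharp)$ (containing its identity $1^{\sharp}$). Then $R$ is itself a left commutative rng with the same left identity $1^{\ell}$ and the restricted operations, with $R_\varepsilon=R\cap U_\varepsilon$ for $\varepsilon=0,1$. Hu-Liu prime ideals. An ideal $p=p_0\oplus p_1$ of a left commutative rng $R$ with $p\neq R$ (where $p_\varepsilon=p\cap R_\varepsilon$) is a Hu-Liu prime ideal of $R$ if (a) for $\varepsilon\in\{0,1\}$, $x_0\in R_0$ and $y_\varepsilon\in R_\varepsilon$: $x_0y_\varepsilon\in p$ implies $x_0\in p_0$ or $y_\varepsilon\in p_\varepsilon$; and (b) for $x_1,y_1\in R_1$: $x_1\,\sharp\,y_1\in p_1$ implies $x_1\in p_1$ or $y_1\in p_1$. Graded integrality. Let $R$ be a left commutative subrng of a left commutative rng $U$. An element $u\in U$ is graded integral over $R$ if, for $\varepsilon=0$ and $\varepsilon=1$, the component $u_\varepsilon\in U_\varepsilon$ is integral over the ring $R_\varepsilon$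 in the usual sense, i.e. $u_\varepsilon$ is a root of a monic polynomial of positive degree with coefficients in $R_\varepsilon$ (with the product $\cdot$ for $\varepsilon=0$ and the product $\sharp$ for $\varepsilon=1$). $U$ is graded integral over $R$ if every $u\in U$ is graded integral over $R$. *)

theory Defs
  imports "HOL-Algebra.Ideal" "HOL-Algebra.Polynomials"
begin

text \<open>
  The field \<open>one\<close> of the record is the fixed left identity; it is not a two-sided identity of
  the rng. The local product \<open>sharp\<close> is a total function on the type, but only its values on the
  additive halo matter; \<open>sharp_one\<close> is its identity there.
\<close>

record 'a lc_rng = "'a ring" +
  sharp :: "['a, 'a] \<Rightarrow> 'a"  (infixl \<open>\<sharp>\<index>\<close> 70)
  sharp_one :: 'a

definition halo :: "('a, 'm) lc_rng_scheme \<Rightarrow> 'a set"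
  where "halo R = {x \<in> carrier R. x \<otimes>\<^bsub>R\<^esub> \<one>\<^bsub>R\<^esub> = \<zero>\<^bsub>R\<^esub>}"

definition halo_ring :: "('a, 'm) lc_rng_scheme \<Rightarrow> 'a ring"
  where "halo_ring R =
    \<lparr>carrier = halo R, monoid.mult = sharp R, monoid.one = sharp_one R, ring.zero = \<zero>\<^bsub>R\<^esub>,
      ring.add = ring.add R\<rparr>"

definition even_part :: "('a, 'm) lc_rng_scheme \<Rightarrow> 'a set"
  where "even_part R = (\<lambda>x. x \<otimes>\<^bsub>R\<^esub> \<one>\<^bsub>R\<^esub>) ` carrier R"

definition even_ring :: "('a, 'm) lc_rng_scheme \<Rightarrow> 'a ring"
  where "even_ring R =
    \<lparr>carrier = even_part R, monoid.mult = monoid.mult R, monoid.one = \<one>\<^bsub>R\<^esub>, ring.zero = \<zero>\<^bsub>R\<^esub>,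
      ring.add = ring.add R\<rparr>"

locale left_commutative_rng = abelian_group R for R :: "('a, 'm) lc_rng_scheme" (structure) +
  assumes m_closed: "\<lbrakk>x \<in> carrier R; y \<in> carrier R\<rbrakk> \<Longrightarrow> x \<otimes> y \<in> carrier R"
    and m_assoc: "\<lbrakk>x \<in> carrier R; y \<in> carrier R; z \<in> carrier R\<rbrakk>
      \<Longrightarrow> (x \<otimes> y) \<otimes> z = x \<otimes> (y \<otimes> z)"
    and l_distr: "\<lbrakk>x \<in> carrier R; y \<in> carrier R; z \<in> carrier R\<rbrakk>
      \<Longrightarrow> (x \<oplus> y) \<otimes> z = x \<otimes> z \<oplus> y \<otimes> z"
    and r_distr: "\<lbrakk>x \<in> carrier R; y \<in> carrier R; z \<in> carrier R\<rbrakk>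
      \<Longrightarrow> z \<otimes> (x \<oplus> y) = z \<otimes> x \<oplus> z \<otimes> y"
    and no_two_sided_identity:
      "\<not> (\<exists>e \<in> carrier R. \<forall>x \<in> carrier R. e \<otimes> x = x \<and> x \<otimes> e = x)"
    and left_comm: "\<lbrakk>x \<in> carrier R; y \<in> carrier R; z \<in> carrier R\<rbrakk>
      \<Longrightarrow> x \<otimes> y \<otimes> z = y \<otimes> x \<otimes> z"
    and one_closed: "\<one> \<in> carrier R"
    and l_one: "x \<in> carrier R \<Longrightarrow> \<one> \<otimes> x = x"
    and halo_cring: "cring (halo_ring R)"
    and m_sharp_assoc: "\<lbrakk>x \<in> carrier R; \<alpha> \<in> halo R; \<beta> \<in> halo R\<rbrakk>
      \<Longrightarrow> (x \<otimes> \<alpha>) \<sharp> \<beta> = x \<otimes> (\<alpha> \<sharp> \<beta>)"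

definition lc_ideal :: "'a set \<Rightarrow> ('a, 'm) lc_rng_scheme \<Rightarrow> bool"
  where "lc_ideal I R \<longleftrightarrow>
    additive_subgroup I R \<and>
    (\<forall>a \<in> I. \<forall>x \<in> carrier R. a \<otimes>\<^bsub>R\<^esub> x \<in> I \<and> x \<otimes>\<^bsub>R\<^esub> a \<in> I) \<and>
    ideal (I \<inter> halo R) (halo_ring R)"

text \<open>A subrng \<open>S\<close> of \<open>U\<close> is viewed as a left commutative rng through \<open>U\<lparr>carrier := S\<rparr>\<close>.\<close>

definition lc_subrng :: "'a set \<Rightarrow> ('a, 'm) lc_rng_scheme \<Rightarrow> bool"
  where "lc_subrng S U \<longleftrightarrow>
    additive_subgroup S U \<and>
    \<one>\<^bsub>U\<^esub> \<in> S \<and>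
    (\<forall>x \<in> S. \<forall>y \<in> S. x \<otimes>\<^bsub>U\<^esub> y \<in> S) \<and>
    subring (S \<inter> halo U) (halo_ring U)"

definition hu_liu_prime :: "'a set \<Rightarrow> ('a, 'm) lc_rng_scheme \<Rightarrow> bool"
  where "hu_liu_prime p R \<longleftrightarrow>
    lc_ideal p R \<and> p \<noteq> carrier R \<and>
    (\<forall>x \<in> even_part R. \<forall>y \<in> even_part R.
      x \<otimes>\<^bsub>R\<^esub> y \<in> p \<longrightarrow> x \<in> p \<inter> even_part R \<or> y \<in> p \<inter> even_part R) \<and>
    (\<forall>x \<in> even_part R. \<forall>y \<in> halo R.
      x \<otimes>\<^bsub>R\<^esub> y \<in> p \<longrightarrow> x \<in> p \<inter> even_part R \<or> y \<in> p \<inter> halo R) \<and>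
    (\<forall>x \<in> halo R. \<forall>y \<in> halo R.
      x \<sharp>\<^bsub>R\<^esub> y \<in> p \<inter> halo R \<longrightarrow> x \<in> p \<inter> halo R \<or> y \<in> p \<inter> halo R)"

text \<open>Polynomials are coefficient lists with the leading coefficient first.\<close>

definition integral_over :: "('a, 'm) ring_scheme \<Rightarrow> 'a set \<Rightarrow> 'a \<Rightarrow> bool"
  where "integral_over A K x \<longleftrightarrow>
    (\<exists>f. set f \<subseteq> K \<and> 0 < degree f \<and> lead_coeff f = \<one>\<^bsub>A\<^esub> \<and> ring.eval A f x = \<zero>\<^bsub>A\<^esub>)"

definition graded_integral_elem :: "'a set \<Rightarrow> ('a, 'm) lc_rng_scheme \<Rightarrow> 'a \<Rightarrow> bool"
  where "graded_integral_elem S U u \<longleftrightarrow>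
    integral_over (even_ring U) (even_part (U\<lparr>carrier := S\<rparr>)) (u \<otimes>\<^bsub>U\<^esub> \<one>\<^bsub>U\<^esub>) \<and>
    integral_over (halo_ring U) (halo (U\<lparr>carrier := S\<rparr>)) (u \<ominus>\<^bsub>U\<^esub> u \<otimes>\<^bsub>U\<^esub> \<one>\<^bsub>U\<^esub>)"

definition graded_integral :: "'a set \<Rightarrow> ('a, 'm) lc_rng_scheme \<Rightarrow> bool"
  where "graded_integral S U \<longleftrightarrow> (\<forall>u \<in> carrier U. graded_integral_elem S U u)"

end

theory Submission
  imports Defs
begin

text \<open>
  Elements of the halo annihilate from the left, so a left commutative rng is a commutative ring
  \<open>R\<^sub>0\<close> together with a commutative \<open>R\<^sub>0\<close>-algebra \<open>R\<^sub>1\<close>, with structure map \<open>\<phi> x = x 1\<^sup>\<sharp>\<close>. A Hu-Liu prime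
  \<open>p\<close> is a prime \<open>p\<^sub>0\<close> of \<open>R\<^sub>0\<close> together with either \<open>p\<^sub>1 = R\<^sub>1\<close>, or a prime \<open>p\<^sub>1\<close> of \<open>R\<^sub>1\<close> such that
  \<open>p\<^sub>0 = \<phi>\<^sup>-\<^sup>1(p\<^sub>1)\<close>. In the first case lift \<open>p\<^sub>0\<close> to a prime \<open>q\<^sub>0\<close> of \<open>U\<^sub>0\<close> and take \<open>q\<^sub>1 = U\<^sub>1\<close>; in the second lift
  \<open>p\<^sub>1\<close> to a prime \<open>q\<^sub>1\<close> of \<open>U\<^sub>1\<close> and take \<open>q\<^sub>0 = \<phi>\<^sup>-\<^sup>1(q\<^sub>1)\<close>.

  For commutative rings \<open>A \<subseteq> B\<close>, lying over needs neither localization nor Cayley-Hamilton: an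
  ideal \<open>q\<close> of \<open>B\<close> maximal among those disjoint from \<open>A - p\<close> is prime. If some \<open>a \<in> p\<close> were not in \<open>q\<close>,
  then \<open>a b \<equiv> s\<close> modulo \<open>q\<close> for some \<open>b \<in> B\<close>, \<open>s \<in> A - p\<close>; multiplying a monic equation of degree \<open>n\<close>
  for \<open>b\<close> by \<open>a\<^sup>n\<close> gives \<open>s\<^sup>n + c \<in> q\<close> with \<open>c \<in> p\<close>, hence \<open>s \<in> p\<close>.
\<close>

section \<open>Lying over for commutative rings\<close>

text \<open>Zorn's lemma on the ideals that contain \<open>I\<close> and avoid \<open>S\<close>. The
  last conclusion is maximality spelled out: for \<open>x\<close> outside \<open>q\<close>, the
  ideal generated by \<open>q\<close> and \<open>x\<close> meets \<open>S\<close>. It yields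
  primality here and is exported because lying over needs it again.\<close>

lemma (in cring) ideal_maximal_disjoint:
  assumes S: "\<one> \<in> S" "\<And>s t. s \<in> S \<Longrightarrow> t \<in> S \<Longrightarrow> s \<otimes> t \<in> S"
    and I: "ideal I R" "I \<inter> S = {}"
  obtains q where "primeideal q R" "I \<subseteq> q" "q \<inter> S = {}"
    and "\<And>x. x \<in> carrier R \<Longrightarrow> x \<notin> q \<Longrightarrow> \<exists>y\<in>q. \<exists>b\<in>carrier R. y \<oplus> b \<otimes> x \<in> S"
proof -
  define F where "F = {J. ideal J R \<and> I \<subseteq> J \<and> J \<inter> S = {}}"
  have "F \<noteq> {}" using I by (auto simp: F_def)
  moreover have "\<Union>C \<in> F" if "C \<noteq> {}" "subset.chain F C" for C
  proof -
    have "C \<subseteq> F" using that(2) by (simp add: pred_on.chain_def)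
    moreover have "subset.chain {J. ideal J R} C"
      using that(2) by (auto simp: pred_on.chain_def F_def)
    then have "ideal (\<Union>C) R"
      using chain_Union_is_ideal[of C] that(1) by simp
    moreover have "I \<subseteq> \<Union>C" "\<Union>C \<inter> S = {}"
      using \<open>C \<subseteq> F\<close> that(1) by (auto simp: F_def)
    ultimately show ?thesis by (simp add: F_def)
  qed
  ultimately obtain q where qF: "q \<in> F" and max: "\<And>J. J \<in> F \<Longrightarrow> q \<subseteq> J \<Longrightarrow> J = q"
    using subset_Zorn_nonempty[of F] by blast
  interpret q: ideal q R using qF by (simp add: F_def)
  have disj: "q \<inter> S = {}" and sub: "I \<subseteq> q" using qF by (auto simp: F_def)
  have ext: "\<exists>y\<in>q. \<exists>b\<in>carrier R. y \<oplus> b \<otimes> x \<in> S" if x: "x \<in> carrier R" "x \<notin> q" for x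
  proof -
    let ?J = "q <+>\<^bsub>R\<^esub> PIdl x"
    have J: "ideal ?J R" using add_ideals[OF q.is_ideal cgenideal_ideal[OF x(1)]] .
    have mem: "u \<in> ?J \<longleftrightarrow> (\<exists>y\<in>q. \<exists>b\<in>carrier R. u = y \<oplus> b \<otimes> x)" for u
      by (auto simp: set_add_def' cgenideal_def)
    have qJ: "q \<subseteq> ?J"
    proof
      fix y assume "y \<in> q"
      moreover have "y = y \<oplus> \<zero> \<otimes> x" using \<open>y \<in> q\<close> x q.Icarr by simp
      ultimately show "y \<in> ?J" unfolding mem by blast
    qed
    have "x = \<zero> \<oplus> \<one> \<otimes> x" using x by simp
    then have "x \<in> ?J" unfolding mem using q.zero_closed by blast
    then have "?J \<notin> F" using max[OF _ qJ] x by blast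
    then have "?J \<inter> S \<noteq> {}" using J qJ sub by (auto simp: F_def)
    then obtain u where "u \<in> ?J" "u \<in> S" by blast
    then show ?thesis using mem[of u] by blast
  qed
  have "primeideal q R"
  proof (rule primeidealI[OF q.is_ideal is_cring])
    show "carrier R \<noteq> q" using disj S(1) by auto
    fix x y assume xy: "x \<in> carrier R" "y \<in> carrier R" "x \<otimes> y \<in> q"
    show "x \<in> q \<or> y \<in> q"
    proof (rule ccontr)
      assume "\<not> ?thesis"
      then obtain u b v c where
        u: "u \<in> q" "b \<in> carrier R" "u \<oplus> b \<otimes> x \<in> S" and
        v: "v \<in> q" "c \<in> carrier R" "v \<oplus> c \<otimes> y \<in> S"
        using ext xy by meson
      \<comment> \<open>Both factors are in \<open>S\<close>, hence so is the product; but every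
        term of the expansion has a factor \<open>u\<close>, \<open>v\<close> or
        \<open>x \<otimes> y\<close> in \<open>q\<close>.\<close>
      have "(u \<oplus> b \<otimes> x) \<otimes> (v \<oplus> c \<otimes> y)
          = u \<otimes> (v \<oplus> c \<otimes> y) \<oplus> (b \<otimes> x \<otimes> v \<oplus> b \<otimes> c \<otimes> (x \<otimes> y))"
        using u v xy q.Icarr by algebra
      also have "\<dots> \<in> q"
        using u v xy q.I_r_closed[of u "v \<oplus> c \<otimes> y"] q.I_l_closed[of v "b \<otimes> x"]
          q.I_l_closed[of "x \<otimes> y" "b \<otimes> c"] q.Icarr
        by (simp add: additive_subgroup.a_closed[OF q.additive_subgroup_axioms])
      finally show False using S(2)[OF u(3) v(3)] disj by blast
    qed
  qed
  then show thesis using that sub disj ext by blast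
qed

text \<open>With \<open>h\<close> the quotient map modulo an ideal, equalities of
  \<open>h\<close>-values are congruences. Multiplied by \<open>a\<close> to the power n+1, a term
  \<open>k\<close> times the n-th power of \<open>b\<close> becomes \<open>a \<otimes> k\<close>
  times the n-th power of \<open>a \<otimes> b\<close>, and \<open>a \<otimes> b\<close> may be
  replaced by \<open>s\<close>. The exponent \<open>length f\<close> exceeds the formal degree by
  one, so each term keeps a spare factor \<open>a\<close>, which puts it in
  \<open>p\<close>.\<close>

lemma (in ring_hom_cring) hom_scaled_eval:
  assumes A: "subring A R" and p: "ideal p (R\<lparr>carrier := A\<rparr>)"
    and a: "a \<in> p" and b: "b \<in> carrier R" and s: "s \<in> A" "h (a \<otimes> b) = h s"
    and f: "set f \<subseteq> A"
  shows "\<exists>c\<in>p. h (a [^] length f \<otimes> R.eval f b) = h c"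
  using f
proof (induction f)
  case Nil
  show ?case
    using additive_subgroup.zero_closed[OF ideal.axioms(1)[OF p]] by (auto intro!: bexI)
next
  case (Cons k f)
  interpret A: subring A R by fact
  interpret p: ideal p "R\<lparr>carrier := A\<rparr>" by fact
  have pA: "p \<subseteq> A" using p.a_subset by simp
  have AR: "A \<subseteq> carrier R" using subringE(1)[OF A] .
  obtain c where c: "c \<in> p" "h (a [^] length f \<otimes> R.eval f b) = h c" using Cons by auto
  let ?n = "length f" and ?e = "R.eval f b"
  have k: "k \<in> A" and carr: "a \<in> carrier R" "k \<in> carrier R" "c \<in> carrier R" "s \<in> carrier R"
    "?e \<in> carrier R"
    using Cons.prems a c s pA AR b R.eval_in_carrier[of f b] by auto
  have "a [^] Suc ?n \<otimes> (k \<otimes> b [^] ?n \<oplus> ?e)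
      = a \<otimes> k \<otimes> (a [^] ?n \<otimes> b [^] ?n) \<oplus> a \<otimes> (a [^] ?n \<otimes> ?e)"
    using carr b R.nat_pow_closed[of a ?n] R.nat_pow_closed[of b ?n] unfolding R.nat_pow_Suc by algebra
  also have "a [^] ?n \<otimes> b [^] ?n = (a \<otimes> b) [^] ?n"
    using carr b by (simp add: R.nat_pow_distrib)
  finally have "h (a [^] Suc ?n \<otimes> (k \<otimes> b [^] ?n \<oplus> ?e)) =
      h (a \<otimes> k) \<otimes>\<^bsub>S\<^esub> h ((a \<otimes> b) [^] ?n) \<oplus>\<^bsub>S\<^esub> h a \<otimes>\<^bsub>S\<^esub> h c"
    using carr b c by simp
  also have "h ((a \<otimes> b) [^] ?n) = h (s [^] ?n)"
    using s carr b by (metis R.m_closed hom_pow)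
  also have "h (a \<otimes> k) \<otimes>\<^bsub>S\<^esub> h (s [^] ?n) \<oplus>\<^bsub>S\<^esub> h a \<otimes>\<^bsub>S\<^esub> h c
      = h (a \<otimes> k \<otimes> s [^] ?n \<oplus> a \<otimes> c)"
    using carr by simp
  finally have "h (a [^] length (k # f) \<otimes> R.eval (k # f) b) = h (a \<otimes> k \<otimes> s [^] ?n \<oplus> a \<otimes> c)"
    by simp
  moreover have "a \<otimes> k \<otimes> s [^] ?n \<oplus> a \<otimes> c \<in> p"
  proof -
    have "s [^] n \<in> A" for n :: nat using s(1) by (induct n) simp_all
    then show ?thesis
      using p.I_r_closed[of "a \<otimes> k" "s [^] ?n"] p.I_r_closed[of a k] p.I_r_closed[of a c]
        additive_subgroup.a_closed[OF p.additive_subgroup_axioms, of "a \<otimes> k \<otimes> s [^] ?n" "a \<otimes> c"] a k c pA by auto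
  qed
  ultimately show ?case by blast
qed

lemma (in cring) lying_over:
  assumes A: "subring A R" and p: "primeideal p (R\<lparr>carrier := A\<rparr>)"
    and int: "\<And>b. b \<in> carrier R \<Longrightarrow> integral_over R A b"
  shows "\<exists>q. primeideal q R \<and> q \<inter> A = p"
proof -
  interpret A: subring A R by fact
  interpret p: primeideal p "R\<lparr>carrier := A\<rparr>" by fact
  have pA: "p \<subseteq> A" using p.a_subset by simp
  have AR: "A \<subseteq> carrier R" using subringE(1)[OF A] .
  have prime: "x \<in> p \<or> y \<in> p" if "x \<in> A" "y \<in> A" "x \<otimes> y \<in> p" for x y
    using p.I_prime[of x y] that by simp
  have one: "\<one> \<notin> p" using p.one_imp_carrier p.I_notcarr by auto
  have zero: "\<zero> \<in> p"
    using additive_subgroup.zero_closed[OF p.additive_subgroup_axioms] by simp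
  obtain q where q: "primeideal q R" "{\<zero>} \<subseteq> q" "q \<inter> (A - p) = {}"
    and ext: "\<And>x. x \<in> carrier R \<Longrightarrow> x \<notin> q \<Longrightarrow> \<exists>y\<in>q. \<exists>b\<in>carrier R. y \<oplus> b \<otimes> x \<in> A - p"
    using ideal_maximal_disjoint[of "A - p" "{\<zero>}", OF _ _ zeroideal] one zero prime
      A.one_closed A.m_closed by auto
  interpret q: primeideal q R by fact
  interpret h: ring_hom_cring R "R Quot q" "(+>) q"
    using q.rcos_ring_hom_cring is_cring by blast
  have heq: "q +> x = q +> y \<longleftrightarrow> x \<ominus> y \<in> q" if "x \<in> carrier R" "y \<in> carrier R" for x y
    using quotient_eq_iff_same_a_r_cos[OF q.is_ideal that] by simp
  \<comment> \<open>Disjointness of \<open>q\<close> from \<open>A - p\<close> already says that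
    \<open>q \<inter> A\<close> is contained in \<open>p\<close>; only this inclusion
    remains.\<close>
  have "p \<subseteq> q"
  proof
    fix a assume a: "a \<in> p"
    show "a \<in> q"
    proof (rule ccontr)
      assume "a \<notin> q"
      have aR: "a \<in> carrier R" using a pA AR by auto
      obtain y b where yb: "y \<in> q" "b \<in> carrier R" "y \<oplus> b \<otimes> a \<in> A - p"
        using ext[OF aR \<open>a \<notin> q\<close>] by blast
      define s where "s = y \<oplus> b \<otimes> a"
      have s: "s \<in> A" "s \<notin> p" "s \<in> carrier R" using yb AR by (auto simp: s_def)
      have "s \<ominus> a \<otimes> b = y" using yb q.Icarr aR unfolding s_def by algebra
      then have hs: "q +> (a \<otimes> b) = q +> s" using heq[of s "a \<otimes> b"] yb aR s by simp
      obtain f where f: "set f \<subseteq> A" "0 < degree f" "lead_coeff f = \<one>" "eval f b = \<zero>"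
        using int[OF yb(2)] by (auto simp: integral_over_def)
      \<comment> \<open>Splitting off the leading \<open>\<one>\<close> leaves a tail whose length
        is the degree of \<open>f\<close>. Thus the scaling exponent for \<open>g\<close> is the one
        that turns the leading term into a power of \<open>a \<otimes> b\<close>.\<close>
      then obtain g where g: "f = \<one> # g" "set g \<subseteq> A" by (cases f) auto
      let ?n = "length g" and ?e = "eval g b"
      obtain c where c: "c \<in> p" "q +> (a [^] ?n \<otimes> ?e) = q +> c"
        using h.hom_scaled_eval[OF A p.is_ideal a yb(2) s(1) hs g(2)] by auto
      have carr: "c \<in> carrier R" "?e \<in> carrier R"
        using c pA AR yb g eval_in_carrier[of g b] by auto
      have "a [^] ?n \<otimes> (b [^] ?n \<oplus> ?e) = (a \<otimes> b) [^] ?n \<oplus> a [^] ?n \<otimes> ?e"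
        using aR yb carr by (simp add: r_distr nat_pow_distrib)
      moreover have "b [^] ?n \<oplus> ?e = \<zero>" using f(4) g yb by simp
      ultimately have "q +> \<zero> = q +> ((a \<otimes> b) [^] ?n \<oplus> a [^] ?n \<otimes> ?e)" 
        using aR by simp
      also have "\<dots> = q +> (s [^] ?n \<oplus> c)"
        using aR yb carr s hs c h.hom_pow[of "a \<otimes> b" ?n] h.hom_pow[of s ?n] by simp
      finally have "s [^] ?n \<oplus> c \<in> q"
        using heq[of "s [^] ?n \<oplus> c" \<zero>] s carr by (simp add: minus_eq)
      moreover have sA: "s [^] n \<in> A" for n :: nat
        using s(1) by (induct n) simp_all
      ultimately have mem: "s [^] ?n \<oplus> c \<in> p" using q(3) c pA subringE(7)[OF A] by blast
      have "s [^] ?n \<in> p"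
      proof -
        \<comment> \<open>Obtained by absorbing the factor \<open>\<ominus> \<one>\<close> from
          \<open>A\<close>, which avoids comparing the additive inverse of the restricted ring with
          that of the whole ring.\<close>
        have "\<ominus> c \<in> p" 
          using p.I_l_closed[of c "\<ominus> \<one>"] c subringE(3,5)[OF A] carr by (simp add: l_minus)
        then have "s [^] ?n \<oplus> c \<oplus> \<ominus> c \<in> p" using additive_subgroup.a_closed[OF p.additive_subgroup_axioms mem] by simp
        then show ?thesis using s carr by (simp add: a_assoc r_neg)
      qed
      moreover have "s [^] n \<notin> p" for n :: nat
        using one s sA prime by (induct n) auto
      ultimately show False by blast
    qed
  qed
  then show ?thesis using q pA by blast
qed


section \<open>The two components of a left commutative rng\<close>

lemma halo_ring_sel [simp]:
  "carrier (halo_ring R) = halo R" "x \<otimes>\<^bsub>halo_ring R\<^esub> y = x \<sharp>\<^bsub>R\<^esub> y"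
  "\<one>\<^bsub>halo_ring R\<^esub> = sharp_one R" "\<zero>\<^bsub>halo_ring R\<^esub> = \<zero>\<^bsub>R\<^esub>" "x \<oplus>\<^bsub>halo_ring R\<^esub> y = x \<oplus>\<^bsub>R\<^esub> y"
  by (simp_all add: halo_ring_def)

lemma even_ring_sel [simp]:
  "carrier (even_ring R) = even_part R" "x \<otimes>\<^bsub>even_ring R\<^esub> y = x \<otimes>\<^bsub>R\<^esub> y"
  "\<one>\<^bsub>even_ring R\<^esub> = \<one>\<^bsub>R\<^esub>" "\<zero>\<^bsub>even_ring R\<^esub> = \<zero>\<^bsub>R\<^esub>" "x \<oplus>\<^bsub>even_ring R\<^esub> y = x \<oplus>\<^bsub>R\<^esub> y"
  by (simp_all add: even_ring_def)

lemma set_add_memI: "a \<in> A \<Longrightarrow> b \<in> B \<Longrightarrow> a \<oplus>\<^bsub>G\<^esub> b \<in> A <+>\<^bsub>G\<^esub> B"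
  by (auto simp: set_add_def')

context left_commutative_rng
begin

lemma l_null: "x \<in> carrier R \<Longrightarrow> \<zero> \<otimes> x = \<zero>"
  using l_distr[of \<zero> \<zero> x] m_closed[of \<zero> x] by (simp add: add.l_cancel_one')

lemma r_null: "x \<in> carrier R \<Longrightarrow> x \<otimes> \<zero> = \<zero>"
  using r_distr[of \<zero> \<zero> x] m_closed[of x \<zero>] by (simp add: add.l_cancel_one')

lemma l_minus: "x \<in> carrier R \<Longrightarrow> y \<in> carrier R \<Longrightarrow> \<ominus> x \<otimes> y = \<ominus> (x \<otimes> y)"
  using l_distr[of "\<ominus> x" x y] m_closed l_null by (simp add: l_neg minus_equality)

lemma halo_iff: "x \<in> halo R \<longleftrightarrow> x \<in> carrier R \<and> x \<otimes> \<one> = \<zero>"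
  by (simp add: halo_def)

text \<open>Right multiplication by \<open>\<one>\<close> is idempotent, so its image is its set of
  fixed points.\<close>

lemma even_part_iff: "x \<in> even_part R \<longleftrightarrow> x \<in> carrier R \<and> x \<otimes> \<one> = x"
proof
  assume "x \<in> even_part R"
  then show "x \<in> carrier R \<and> x \<otimes> \<one> = x"
    using m_assoc m_closed one_closed l_one by (auto simp: even_part_def)
qed (force simp: even_part_def)

text \<open>Insert the left identity: \<open>x \<otimes> y = x \<otimes> (\<one> \<otimes> y) = (x
  \<otimes> \<one>) \<otimes> y\<close>.\<close>

lemma halo_mult: "x \<in> halo R \<Longrightarrow> y \<in> carrier R \<Longrightarrow> x \<otimes> y = \<zero>"
  using m_assoc[of x \<one> y] by (simp add: halo_iff one_closed l_one l_null)

lemma mult_halo: "x \<in> carrier R \<Longrightarrow> y \<in> halo R \<Longrightarrow> x \<otimes> y \<in> halo R"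
  using m_assoc[of x y \<one>] by (simp add: halo_iff one_closed m_closed r_null)

lemma even_add_halo_component:
  assumes "a \<in> even_part R" "b \<in> halo R"
  shows "(a \<oplus> b) \<otimes> \<one> = a"
  using assms by (simp add: l_distr halo_iff even_part_iff one_closed)

lemma even_component: "x \<in> carrier R \<Longrightarrow> x \<otimes> \<one> \<in> even_part R"
  by (simp add: even_part_def)

lemma halo_component:
  assumes "x \<in> carrier R"
  shows "x \<ominus> x \<otimes> \<one> \<in> halo R" "x \<otimes> \<one> \<oplus> (x \<ominus> x \<otimes> \<one>) = x"
proof -
  have "x \<otimes> \<one> \<in> carrier R" "x \<otimes> \<one> \<otimes> \<one> = x \<otimes> \<one>"
    using assms m_closed one_closed m_assoc l_one by auto
  then show "x \<ominus> x \<otimes> \<one> \<in> halo R"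
    using assms one_closed by (simp add: halo_iff minus_eq l_distr l_minus r_neg)
  show "x \<otimes> \<one> \<oplus> (x \<ominus> x \<otimes> \<one>) = x"
    using assms \<open>x \<otimes> \<one> \<in> carrier R\<close> by (simp add: minus_eq a_lcomm r_neg)
qed

lemma one_even: "\<one> \<in> even_part R"
  by (simp add: even_part_iff one_closed l_one)

lemma even_cring: "cring (even_ring R)"
proof (rule cringI)
  have "\<exists>y\<in>even_part R. y \<oplus> x = \<zero>" if "x \<in> even_part R" for x
    using that l_minus one_closed by (intro bexI[of _ "\<ominus> x"]) (auto simp: even_part_iff l_neg)
  then show "abelian_group (even_ring R)"
    by (intro abelian_groupI)
      (auto simp: even_part_iff l_distr l_null one_closed a_ac)
  show "Group.comm_monoid (even_ring R)"
  proof (rule comm_monoidI)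
    fix x y assume xy: "x \<in> carrier (even_ring R)" "y \<in> carrier (even_ring R)"
    then show "x \<otimes>\<^bsub>even_ring R\<^esub> y \<in> carrier (even_ring R)"
      by (simp add: even_part_iff m_closed m_assoc one_closed)
    \<comment> \<open>Left commutativity with third factor \<open>\<one>\<close>, which acts as a
      right identity on even elements.\<close>
    show "x \<otimes>\<^bsub>even_ring R\<^esub> y = y \<otimes>\<^bsub>even_ring R\<^esub> x"
      using xy left_comm[of x y \<one>] by (simp add: even_part_iff m_assoc one_closed)
  qed (auto simp: even_part_iff m_assoc l_one one_closed)
qed (auto simp: even_part_iff l_distr)

end

sublocale left_commutative_rng \<subseteq> even: cring "even_ring R"
  rewrites "carrier (even_ring R) = even_part R" and "monoid.mult (even_ring R) = monoid.mult R"
    and "ring.add (even_ring R) = ring.add R" and "\<one>\<^bsub>even_ring R\<^esub> = \<one>" and "\<zero>\<^bsub>even_ring R\<^esub> = \<zero>"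
  using even_cring by (simp_all add: even_ring_def)

sublocale left_commutative_rng \<subseteq> odd: cring "halo_ring R"
  rewrites "carrier (halo_ring R) = halo R" and "monoid.mult (halo_ring R) = sharp R"
    and "ring.add (halo_ring R) = ring.add R" and "\<one>\<^bsub>halo_ring R\<^esub> = sharp_one R" and "\<zero>\<^bsub>halo_ring R\<^esub> = \<zero>"
  using halo_cring by (simp_all add: halo_ring_def)

context left_commutative_rng
begin

text \<open>As a simp rule, \<open>even.r_one\<close> loops with \<open>even_part_iff\<close>, which restates its premise as an instance of its left-hand side.\<close>

declare even.r_one [simp del]

section \<open>Additive structure of the components and the structure map\<close>

lemma halo_minus: "x \<in> halo R \<Longrightarrow> \<ominus>\<^bsub>halo_ring R\<^esub> x = \<ominus> x"
  using odd.a_inv_closed[of x] odd.l_neg[of x]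
  by (intro minus_equality[symmetric]) (auto simp: halo_iff)

lemma even_minus: "x \<in> even_part R \<Longrightarrow> \<ominus>\<^bsub>even_ring R\<^esub> x = \<ominus> x"
  using even.a_inv_closed[of x] even.l_neg[of x]
  by (intro minus_equality[symmetric]) (auto simp: even_part_iff)

text \<open>Inverses in \<open>halo_ring R\<close> are defined relative to the smaller carrier; once
  they are known to agree with those of \<open>R\<close>, subgroups can be moved between the two
  rings.\<close>

lemma additive_subgroup_halo_iff:
  "additive_subgroup I (halo_ring R) \<longleftrightarrow> additive_subgroup I R \<and> I \<subseteq> halo R"
proof -
  have "halo R \<subseteq> carrier R" by (auto simp: halo_iff)
  then show ?thesis
    unfolding additive_subgroup_def subgroup_def a_inv_def[symmetric]
    by (auto simp: halo_minus subset_eq)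
qed

lemma additive_subgroup_even_iff:
  "additive_subgroup I (even_ring R) \<longleftrightarrow> additive_subgroup I R \<and> I \<subseteq> even_part R"
proof -
  have "even_part R \<subseteq> carrier R" by (auto simp: even_part_iff)
  then show ?thesis
    unfolding additive_subgroup_def subgroup_def a_inv_def[symmetric]
    by (auto simp: even_minus subset_eq)
qed

lemma even_part_subgroup: "additive_subgroup (even_part R) R"
proof (rule additive_subgroupI, rule add.subgroupI)
  show "\<ominus> x \<in> even_part R" if "x \<in> even_part R" for x
    using even_minus[OF that] even.a_inv_closed[OF that] by simp
  show "even_part R \<noteq> {}" using one_even by blast
  show "even_part R \<subseteq> carrier R" by (auto simp: even_part_iff)
  show "x \<oplus> y \<in> even_part R" if "x \<in> even_part R" "y \<in> even_part R" for x y
    using that even.a_closed by simp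
qed

text \<open>Write \<open>y\<close> as \<open>sharp_one R \<sharp> y\<close> and use the
  compatibility of the two products. Hence \<open>x\<close> acts on the halo as local multiplication
  by \<phi>(x).\<close>

lemma mult_eq_sharp:
  assumes "x \<in> carrier R" "y \<in> halo R"
  shows "x \<otimes> y = (x \<otimes> sharp_one R) \<sharp> y" "x \<otimes> sharp_one R \<in> halo R"
  using m_sharp_assoc[of x "sharp_one R" y] assms mult_halo by simp_all

text \<open>This map is \<phi>. It is multiplicative because
  \<open>x \<otimes> (y \<otimes> sharp_one R)\<close> is the action of \<open>x\<close> on
  \<phi>(y), that is, the local product of \<phi>(x) and \<phi>(y).\<close>

lemma hom_even_halo: "(\<lambda>x. x \<otimes> sharp_one R) \<in> ring_hom (even_ring R) (halo_ring R)"
proof (rule ring_hom_memI)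
  have one: "sharp_one R \<in> carrier R" using odd.one_closed by (simp add: halo_iff)
  fix x y assume "x \<in> carrier (even_ring R)" "y \<in> carrier (even_ring R)"
  then have xy: "x \<in> carrier R" "y \<in> carrier R" by (simp_all add: even_part_iff)
  show "x \<otimes> sharp_one R \<in> carrier (halo_ring R)"
    using mult_eq_sharp(2)[OF xy(1) odd.one_closed] by simp
  show "(x \<otimes>\<^bsub>even_ring R\<^esub> y) \<otimes> sharp_one R = (x \<otimes> sharp_one R) \<otimes>\<^bsub>halo_ring R\<^esub> (y \<otimes> sharp_one R)"
    using m_assoc[OF xy one] mult_eq_sharp(1)[OF xy(1) mult_halo[OF xy(2) odd.one_closed]] by simp
  show "(x \<oplus>\<^bsub>even_ring R\<^esub> y) \<otimes> sharp_one R = (x \<otimes> sharp_one R) \<oplus>\<^bsub>halo_ring R\<^esub> (y \<otimes> sharp_one R)"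
    using l_distr xy one by simp
next
  show "\<one>\<^bsub>even_ring R\<^esub> \<otimes> sharp_one R = \<one>\<^bsub>halo_ring R\<^esub>"
    using l_one odd.one_closed by (simp add: halo_iff)
qed

lemma even_hom_ring: "ring_hom_ring (even_ring R) (halo_ring R) (\<lambda>x. x \<otimes> sharp_one R)"
  using ring_hom_ringI2[OF even.ring_axioms odd.ring_axioms hom_even_halo] .

section \<open>Ideals and Hu-Liu primes in terms of their components\<close>

lemma lc_ideal_components:
  assumes "lc_ideal I R"
  shows "ideal (I \<inter> even_part R) (even_ring R)" "ideal (I \<inter> halo R) (halo_ring R)"
    "I = (I \<inter> even_part R) <+>\<^bsub>R\<^esub> (I \<inter> halo R)"
proof -
  interpret I: additive_subgroup I R using assms by (simp add: lc_ideal_def)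
  have mult: "a \<otimes> x \<in> I" "x \<otimes> a \<in> I" if "a \<in> I" "x \<in> carrier R" for a x
    using assms that by (auto simp: lc_ideal_def)
  have sub: "x \<ominus> y \<in> I" if "x \<in> I" "y \<in> I" for x y
    using that by (simp add: minus_eq)
  show "ideal (I \<inter> even_part R) (even_ring R)"
  proof (rule idealI)
    have "additive_subgroup (I \<inter> even_part R) R"
      using add.subgroups_Inter_pair[OF I.a_subgroup additive_subgroup.a_subgroup[OF even_part_subgroup]]
      by (rule additive_subgroupI)
    then show "subgroup (I \<inter> even_part R) (add_monoid (even_ring R))"
      by (intro additive_subgroup.a_subgroup) (simp add: additive_subgroup_even_iff)
    fix a x assume "a \<in> I \<inter> even_part R" "x \<in> carrier (even_ring R)"
    then show "x \<otimes>\<^bsub>even_ring R\<^esub> a \<in> I \<inter> even_part R" "a \<otimes>\<^bsub>even_ring R\<^esub> x \<in> I \<inter> even_part R"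
      using mult even.m_closed by (auto simp: even_part_iff)
  qed (rule even.ring_axioms)
  show "ideal (I \<inter> halo R) (halo_ring R)" using assms by (simp add: lc_ideal_def)
  show "I = (I \<inter> even_part R) <+>\<^bsub>R\<^esub> (I \<inter> halo R)"
  proof
    show "I \<subseteq> (I \<inter> even_part R) <+>\<^bsub>R\<^esub> (I \<inter> halo R)"
    proof
      fix x assume x: "x \<in> I"
      then have xR: "x \<in> carrier R" using I.a_subset by blast
      \<comment> \<open>An ideal absorbs \<open>\<one>\<close> on the right, so it contains the even
        component of \<open>x\<close> and then, by subtraction, the halo component.\<close>
      have "x \<otimes> \<one> \<in> I" using mult(1)[OF x one_closed] .
      then have "x \<otimes> \<one> \<in> I \<inter> even_part R" "x \<ominus> x \<otimes> \<one> \<in> I \<inter> halo R"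
        using even_component[OF xR] halo_component(1)[OF xR] sub[OF x] by blast+
      from set_add_memI[OF this, of R] show "x \<in> (I \<inter> even_part R) <+>\<^bsub>R\<^esub> (I \<inter> halo R)"
        using halo_component(2)[OF xR] by simp
    qed
  qed (auto simp: set_add_def')
qed

text \<open>Right multiplication by \<open>\<one>\<close> sends \<open>a \<oplus> b\<close> to
  \<open>a\<close>. An even sum therefore equals \<open>a\<close>, and a sum in the halo has
  \<open>a = \<zero>\<close>.\<close>

lemma even_halo_sum:
  assumes "A \<subseteq> even_part R" "B \<subseteq> halo R" "\<zero> \<in> A" "\<zero> \<in> B"
  shows "(A <+>\<^bsub>R\<^esub> B) \<inter> even_part R = A" "(A <+>\<^bsub>R\<^esub> B) \<inter> halo R = B"
proof -
  have comp: "(a \<oplus> b) \<otimes> \<one> = a" "a \<in> carrier R" "b \<in> carrier R" if "a \<in> A" "b \<in> B" for a b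
  proof -
    have "a \<in> even_part R" "b \<in> halo R" using that assms by blast+
    then show "(a \<oplus> b) \<otimes> \<one> = a" "a \<in> carrier R" "b \<in> carrier R"
      using even_add_halo_component by (simp_all add: even_part_iff halo_iff)
  qed
  show "(A <+>\<^bsub>R\<^esub> B) \<inter> even_part R = A"
  proof (intro equalityI subsetI)
    fix x assume x: "x \<in> (A <+>\<^bsub>R\<^esub> B) \<inter> even_part R"
    then obtain a b where ab: "a \<in> A" "b \<in> B" "x = a \<oplus> b" unfolding set_add_def' by blast
    then show "x \<in> A" using comp(1)[OF ab(1,2)] x by (simp add: even_part_iff)
  next
    fix x assume x: "x \<in> A"
    then show "x \<in> (A <+>\<^bsub>R\<^esub> B) \<inter> even_part R"
      using set_add_memI[OF x assms(4), of R] comp(2)[OF x assms(4)] subsetD[OF assms(1) x] by simp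
  qed
  show "(A <+>\<^bsub>R\<^esub> B) \<inter> halo R = B"
  proof (intro equalityI subsetI)
    fix x assume x: "x \<in> (A <+>\<^bsub>R\<^esub> B) \<inter> halo R"
    then obtain a b where ab: "a \<in> A" "b \<in> B" "x = a \<oplus> b" unfolding set_add_def' by blast
    then show "x \<in> B" using comp[OF ab(1,2)] x by (simp add: halo_iff)
  next
    fix x assume x: "x \<in> B"
    then show "x \<in> (A <+>\<^bsub>R\<^esub> B) \<inter> halo R"
      using set_add_memI[OF assms(3) x, of R] comp(3)[OF assms(3) x] subsetD[OF assms(2) x] by simp
  qed
qed

text \<open>Converse to the decomposition of ideals. The assumption that \<phi> maps
  \<open>I\<close> into \<open>J\<close> handles the one delicate product, an element
  \<open>a\<close> of \<open>I\<close> times \<open>v\<close> in the halo: it is the local product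
  of \<phi>(a) and \<open>v\<close>.\<close>

lemma lc_ideal_sum:
  assumes I: "ideal I (even_ring R)" and J: "ideal J (halo_ring R)"
    and IJ: "\<And>x. x \<in> I \<Longrightarrow> x \<otimes> sharp_one R \<in> J"
  shows "lc_ideal (I <+>\<^bsub>R\<^esub> J) R"
proof -
  interpret I: ideal I "even_ring R" by fact
  interpret J: ideal J "halo_ring R" by fact
  have sub: "I \<subseteq> even_part R" "J \<subseteq> halo R" using I.a_subset J.a_subset by auto
  have zero: "\<zero> \<in> I" "\<zero> \<in> J" using I.zero_closed J.zero_closed by auto
  have "additive_subgroup (I <+>\<^bsub>R\<^esub> J) R"
    using I.additive_subgroup_axioms J.additive_subgroup_axioms
    by (intro add_additive_subgroups) (simp_all add: additive_subgroup_even_iff additive_subgroup_halo_iff)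
  moreover have "c \<otimes> x \<in> I <+>\<^bsub>R\<^esub> J \<and> x \<otimes> c \<in> I <+>\<^bsub>R\<^esub> J"
    if c: "c \<in> I <+>\<^bsub>R\<^esub> J" and x: "x \<in> carrier R" for c x
  proof -
    obtain a b where ab: "a \<in> I" "b \<in> J" "c = a \<oplus> b" using c unfolding set_add_def' by blast
    define u v where uv: "u = x \<otimes> \<one>" "v = x \<ominus> x \<otimes> \<one>"
    have u: "u \<in> even_part R" and v: "v \<in> halo R" and xuv: "x = u \<oplus> v"
      using halo_component[OF x] even_component[OF x] by (simp_all add: uv)
    have carr: "a \<in> carrier R" "b \<in> carrier R" "u \<in> carrier R" "v \<in> carrier R" "a \<in> even_part R"
      "b \<in> halo R"
      using ab sub u v by (auto simp: even_part_iff halo_iff)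
    have "c \<otimes> x = a \<otimes> u \<oplus> a \<otimes> v"
      using ab xuv carr halo_mult[OF carr(6)] x by (simp add: l_distr r_distr m_closed)
    moreover have "a \<otimes> u \<in> I" using I.I_r_closed[of a u] ab u by simp
    moreover have "a \<otimes> v \<in> J"
      using mult_eq_sharp[of a v] J.I_r_closed[OF IJ[OF ab(1)], of v] carr v by simp
    moreover have "x \<otimes> c = u \<otimes> a \<oplus> u \<otimes> b"
      using ab xuv carr halo_mult[OF v, of a] halo_mult[OF v, of b]
      by (simp add: l_distr r_distr m_closed)
    moreover have "u \<otimes> a \<in> I" using I.I_l_closed[of a u] ab u by simp
    moreover have "u \<otimes> b \<in> J"
      using mult_eq_sharp[of u b] J.I_l_closed[OF ab(2), of "u \<otimes> sharp_one R"] carr by simp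
    ultimately show ?thesis by (simp add: set_add_memI)
  qed
  ultimately show ?thesis
    using J even_halo_sum(2)[OF sub zero] by (simp add: lc_ideal_def)
qed

text \<open>If the halo is not inside \<open>q\<close>, then \<open>sharp_one R\<close> is not in
  \<open>q\<close>, and the mixed primality condition at \<open>y = sharp_one R\<close> gives the
  condition on \<phi>. Conversely, \<open>x \<otimes> y\<close> is the local product of \<phi>(x)
  and \<open>y\<close>, so primality in the halo together with that condition gives mixed primality.
  If the halo is inside \<open>q\<close>, both conditions involving it are trivial.\<close>

lemma hu_liu_prime_iff:
  "hu_liu_prime q R \<longleftrightarrow> lc_ideal q R \<and> primeideal (q \<inter> even_part R) (even_ring R) \<and>
    (halo R \<subseteq> q \<or> primeideal (q \<inter> halo R) (halo_ring R) \<and>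
      (\<forall>x\<in>even_part R. x \<otimes> sharp_one R \<in> q \<longrightarrow> x \<in> q))"
  (is "?L \<longleftrightarrow> ?R")
proof
  assume L: ?L
  then have q: "lc_ideal q R" by (simp add: hu_liu_prime_def)
  interpret q: additive_subgroup q R using q by (simp add: lc_ideal_def)
  note comp = lc_ideal_components[OF q]
  \<comment> \<open>Properness of \<open>q\<close> as a whole must give properness of its even part;
    a left identity in \<open>q\<close> would already generate everything.\<close>
  have "\<one> \<notin> q"
  proof
    assume "\<one> \<in> q"
    then have "\<one> \<otimes> x \<in> q" if "x \<in> carrier R" for x
      using q that unfolding lc_ideal_def by blast
    then have "carrier R \<subseteq> q" using l_one by auto
    then have "q = carrier R" using q.a_subset by blast
    then show False using L unfolding hu_liu_prime_def by blast
  qed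
  have prime: "x \<in> q \<or> y \<in> q"
    if "x \<in> even_part R" "y \<in> even_part R \<or> y \<in> halo R" "x \<otimes> y \<in> q" for x y
    using L that unfolding hu_liu_prime_def by blast
  have prime': "x \<in> q \<or> y \<in> q" if "x \<in> halo R" "y \<in> halo R" "x \<sharp> y \<in> q" for x y
    using L that odd.m_closed[of x y] unfolding hu_liu_prime_def by blast
  have q0: "primeideal (q \<inter> even_part R) (even_ring R)"
  proof (rule primeidealI[OF comp(1) even_cring])
    show "carrier (even_ring R) \<noteq> q \<inter> even_part R" using \<open>\<one> \<notin> q\<close> one_even by auto
  qed (use prime in auto)
  have q1: "primeideal (q \<inter> halo R) (halo_ring R)" if "\<not> halo R \<subseteq> q"
  proof (rule primeidealI[OF comp(2) halo_cring])
    show "carrier (halo_ring R) \<noteq> q \<inter> halo R" using that by auto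
  qed (use prime' in auto)
  have "x \<in> q" if "\<not> halo R \<subseteq> q" "x \<in> even_part R" "x \<otimes> sharp_one R \<in> q" for x
  proof -
    have "sharp_one R \<notin> q"
    proof
      assume "sharp_one R \<in> q"
      then have "halo R = q \<inter> halo R"
        using ideal.one_imp_carrier[OF comp(2)] odd.one_closed by simp
      then show False using that(1) by blast
    qed
    then show ?thesis using prime[OF that(2) _ that(3)] odd.one_closed by blast
  qed
  then show ?R using q q0 q1 by blast
next
  assume R: ?R
  then have q: "lc_ideal q R" and q0': "primeideal (q \<inter> even_part R) (even_ring R)" by simp_all
  interpret q0: primeideal "q \<inter> even_part R" "even_ring R" by (rule q0')
  have "even_part R \<subseteq> carrier R" by (auto simp: even_part_iff)
  then have ne: "q \<noteq> carrier R" using q0.I_notcarr by auto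
  have even: "x \<in> q \<or> y \<in> q"
    if "x \<in> even_part R" "y \<in> even_part R" "x \<otimes> y \<in> q" for x y
    using q0.I_prime[of x y] that even.m_closed[of x y] by auto
  have odd: "x \<in> q \<or> y \<in> q" if xy: "x \<in> halo R" "y \<in> halo R" "x \<sharp> y \<in> q" for x y
  proof (cases "halo R \<subseteq> q")
    case False
    then have "primeideal (q \<inter> halo R) (halo_ring R)" using R by blast
    from primeideal.I_prime[OF this, of x y] show ?thesis
      using xy odd.m_closed[of x y] by auto
  qed (use xy in blast)
  have mixed: "x \<in> q \<or> y \<in> q" if xy: "x \<in> even_part R" "y \<in> halo R" "x \<otimes> y \<in> q" for x y
  proof (cases "halo R \<subseteq> q")
    case False
    have "x \<in> carrier R" using xy(1) by (simp add: even_part_iff)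
    note x = mult_eq_sharp(1)[OF this xy(2)] mult_eq_sharp(2)[OF this xy(2)]
    have "x \<otimes> sharp_one R \<in> q \<or> y \<in> q" using odd[OF x(2) xy(2)] xy(3) x(1) by metis
    then show ?thesis using R False xy(1) by blast
  qed (use xy in blast)
  show ?L unfolding hu_liu_prime_def using q ne even odd mixed by blast
qed

end

section \<open>Left commutative subrngs\<close>

locale left_commutative_subrng = left_commutative_rng U for U :: "('a, 'm) lc_rng_scheme" (structure) +
  fixes R :: "'a set"
  assumes subrng: "lc_subrng R U"
begin

lemma sub_halo: "halo (U\<lparr>carrier := R\<rparr>) = R \<inter> halo U"
  and sub_halo_ring: "halo_ring (U\<lparr>carrier := R\<rparr>) = (halo_ring U)\<lparr>carrier := R \<inter> halo U\<rparr>"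
  using subrng additive_subgroup.a_subset[of R U] by (auto simp: halo_def halo_ring_def lc_subrng_def)

lemma sub_even: "even_part (U\<lparr>carrier := R\<rparr>) = R \<inter> even_part U"
proof -
  have R: "x \<in> carrier U" "x \<otimes> \<one> \<in> R" if "x \<in> R" for x
    using subrng additive_subgroup.a_subset[of R U] that unfolding lc_subrng_def by blast+
  have "even_part (U\<lparr>carrier := R\<rparr>) = (\<lambda>x. x \<otimes> \<one>) ` R" by (simp add: even_part_def)
  also have "\<dots> = R \<inter> even_part U"
  proof (intro equalityI subsetI)
    fix y assume "y \<in> R \<inter> even_part U"
    then have "y = y \<otimes> \<one>" "y \<in> R" by (simp_all add: even_part_iff)
    then show "y \<in> (\<lambda>x. x \<otimes> \<one>) ` R" by (rule image_eqI)
  qed (use R even_component in auto)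
  finally show ?thesis .
qed

lemma sub_even_ring: "even_ring (U\<lparr>carrier := R\<rparr>) = (even_ring U)\<lparr>carrier := R \<inter> even_part U\<rparr>"
  using sub_even by (simp add: even_ring_def)

lemma halo_subring: "subring (R \<inter> halo U) (halo_ring U)"
  using subrng by (simp add: lc_subrng_def)

lemma sharp_one_in_sub: "sharp_one U \<in> R"
  using subringE(3)[OF halo_subring] by simp

text \<open>The equational axioms restrict to \<open>R\<close>; the absence of a two-sided identity
  does not restrict formally and needs \<open>sharp_one U \<in> R\<close>.\<close>

lemma sub_left_commutative_rng: "left_commutative_rng (U\<lparr>carrier := R\<rparr>)"
proof -
  interpret R: additive_subgroup R U using subrng by (simp add: lc_subrng_def)
  have R: "x \<in> carrier U" if "x \<in> R" for x using that R.a_subset by blast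
  have mult: "x \<otimes> y \<in> R" if "x \<in> R" "y \<in> R" for x y using subrng that by (simp add: lc_subrng_def)
  have one: "\<one> \<in> R" using subrng by (simp add: lc_subrng_def)
  have "comm_group ((add_monoid U)\<lparr>carrier := R\<rparr>)"
    by (rule group.group_comm_groupI[OF add.subgroup_imp_group[OF R.a_subgroup]])
      (simp add: a_comm R)
  then have ab: "abelian_group (U\<lparr>carrier := R\<rparr>)"
    by (simp add: abelian_group_def abelian_monoid_def abelian_group_axioms_def comm_group_def)
  \<comment> \<open>A right identity of \<open>R\<close> would give \<open>1\<^sup>\<sharp> = 1\<^sup>\<sharp> e = 0\<close>, so the halo of \<open>U\<close> would vanish and \<open>1\<close> would be two-sided.\<close>
  have "\<not> (\<forall>x\<in>R. x \<otimes> e = x)" if "e \<in> R" for e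
  proof
    assume "\<forall>x\<in>R. x \<otimes> e = x"
    then have "sharp_one U = \<zero>"
      using sharp_one_in_sub halo_mult[of "sharp_one U" e] R[OF that] odd.one_closed by simp
    then have zero: "x = \<zero>" if "x \<in> halo U" for x
      using that odd.one_zeroD by auto
    have "x \<otimes> \<one> = x" if "x \<in> carrier U" for x
      using halo_component(2)[OF that] zero[OF halo_component(1)[OF that]]
        m_closed[OF that one_closed] by simp
    then show False using no_two_sided_identity one_closed l_one by blast
  qed
  then have "\<not> (\<exists>e\<in>R. \<forall>x\<in>R. e \<otimes> x = x \<and> x \<otimes> e = x)" by blast
  moreover have "cring ((halo_ring U)\<lparr>carrier := R \<inter> halo U\<rparr>)"
    using odd.subcring_iff odd.subcringI'[OF halo_subring] subringE(1)[OF halo_subring] by simp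
  ultimately show ?thesis
    using ab mult one R m_assoc l_distr r_distr left_comm l_one m_sharp_assoc
    by (intro left_commutative_rng.intro left_commutative_rng_axioms.intro)
      (auto simp: sub_halo_ring sub_halo)
qed

text \<open>\<open>lc_subrng\<close> asks for a subring only in the halo. In the even part it
  follows because the even ring of the restricted structure is a ring with the operations and
  identity of \<open>even_ring U\<close>.\<close>

lemma even_subring: "subring (R \<inter> even_part U) (even_ring U)"
  using left_commutative_rng.even_cring[OF sub_left_commutative_rng]
  by (intro even.ring_incl_imp_subring) (simp_all add: sub_even_ring cring.axioms)

section \<open>Integrality of homogeneous elements and lifting of Hu-Liu primes\<close>

lemma even_integral:
  assumes "graded_integral R U" "x \<in> even_part U"
  shows "integral_over (even_ring U) (R \<inter> even_part U) x"
proof -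
  have x: "x \<in> carrier U" "x \<otimes> \<one> = x" using assms(2) by (auto simp: even_part_iff)
  then have "graded_integral_elem R U x" using assms(1) unfolding graded_integral_def by blast
  then show ?thesis unfolding graded_integral_elem_def x(2) sub_even by simp
qed

lemma halo_integral:
  assumes "graded_integral R U" "x \<in> halo U"
  shows "integral_over (halo_ring U) (R \<inter> halo U) x"
proof -
  have x: "x \<in> carrier U" "x \<ominus> x \<otimes> \<one> = x" using assms(2) by (auto simp: halo_iff minus_eq)
  then have "graded_integral_elem R U x" using assms(1) unfolding graded_integral_def by blast
  then show ?thesis unfolding graded_integral_elem_def x(2) sub_halo by simp
qed

lemma hu_liu_lying_over:
  assumes int: "graded_integral R U" and p: "hu_liu_prime p (U\<lparr>carrier := R\<rparr>)"
  shows "\<exists>q. hu_liu_prime q U \<and> q \<inter> R = p"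
proof -
  interpret S: left_commutative_rng "U\<lparr>carrier := R\<rparr>" by (rule sub_left_commutative_rng)
  let ?p0 = "p \<inter> even_part U" and ?p1 = "p \<inter> halo U"
  have pi: "lc_ideal p (U\<lparr>carrier := R\<rparr>)" using p by (simp add: hu_liu_prime_def)
  have pR: "p \<subseteq> R" using pi additive_subgroup.a_subset by (force simp: lc_ideal_def)
  have int0: "p \<inter> (R \<inter> even_part U) = ?p0" and int1: "p \<inter> (R \<inter> halo U) = ?p1"
    using pR by auto
  note p' = p[unfolded S.hu_liu_prime_iff sub_even sub_halo sub_even_ring sub_halo_ring int0 int1]
  \<comment> \<open>The assembly shared by both cases: \<open>q01\<close> makes the sum of
    \<open>q0\<close> and \<open>q1\<close> an ideal, \<open>q10\<close> makes it Hu-Liu prime, and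
    the two contraction conditions give its intersection with \<open>R\<close>.\<close>
  have comp: "\<exists>q. hu_liu_prime q U \<and> q \<inter> R = p"
    if q0: "primeideal q0 (even_ring U)" "q0 \<inter> (R \<inter> even_part U) = ?p0"
      and q1: "ideal q1 (halo_ring U)" "q1 \<inter> (R \<inter> halo U) = ?p1"
      and q01: "\<And>x. x \<in> q0 \<Longrightarrow> x \<otimes> sharp_one U \<in> q1"
      and q10: "q1 = halo U \<or> primeideal q1 (halo_ring U) \<and>
        (\<forall>x\<in>even_part U. x \<otimes> sharp_one U \<in> q1 \<longrightarrow> x \<in> q0)"
    for q0 q1
  proof -
    let ?q = "q0 <+>\<^bsub>U\<^esub> q1"
    interpret q0: primeideal q0 "even_ring U" by fact
    interpret q1: ideal q1 "halo_ring U" by fact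
    have sub: "q0 \<subseteq> even_part U" "q1 \<subseteq> halo U" "\<zero> \<in> q0" "\<zero> \<in> q1"
      using q0.a_subset q1.a_subset additive_subgroup.zero_closed[OF q0.additive_subgroup_axioms]
        additive_subgroup.zero_closed[OF q1.additive_subgroup_axioms] by auto
    note parts = even_halo_sum[OF sub]
    have q: "lc_ideal ?q U" by (rule lc_ideal_sum[OF q0.is_ideal q1(1) q01])
    have "x \<in> ?q \<longleftrightarrow> x \<in> q1" if "x \<in> halo U" for x using parts(2) that by blast
    moreover have "x \<in> ?q \<longleftrightarrow> x \<in> q0" if "x \<in> even_part U" for x using parts(1) that by blast
    moreover have "x \<otimes> sharp_one U \<in> halo U" if "x \<in> even_part U" for x
      using that mult_halo odd.one_closed by (simp add: even_part_iff)
    ultimately have "hu_liu_prime ?q U"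
      using q q0(1) q10 unfolding hu_liu_prime_iff parts by blast
    moreover have "?q \<inter> R = p"
    proof
      have p_sum: "p = ?p0 <+>\<^bsub>U\<^esub> ?p1"
        using S.lc_ideal_components(3)[OF pi] by (simp add: sub_even sub_halo int0 int1 set_add_def')
      show "p \<subseteq> ?q \<inter> R"
      proof -
        have "?p0 \<subseteq> q0" "?p1 \<subseteq> q1" using q0(2) q1(2) by auto
        then have "?p0 <+>\<^bsub>U\<^esub> ?p1 \<subseteq> ?q" unfolding set_add_def' by blast
        then show ?thesis using p_sum pR by blast
      qed
      show "?q \<inter> R \<subseteq> p"
      proof
        fix x assume x: "x \<in> ?q \<inter> R"
        then obtain a b where ab: "a \<in> q0" "b \<in> q1" "x = a \<oplus> b" unfolding set_add_def' by blast
        have xR: "x \<in> carrier (U\<lparr>carrier := R\<rparr>)" using x by simp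
        have parts: "a \<in> even_part U" "b \<in> halo U" using ab sub by blast+
        then have carr: "a \<in> carrier U" "b \<in> carrier U"
          unfolding even_part_iff halo_iff by blast+
        \<comment> \<open>Since \<open>R\<close> contains \<open>\<one>\<close>, it contains both
          components of each of its elements, so each contraction condition applies to its own
          component.\<close>
        have "a = x \<otimes> \<one>" using even_add_halo_component[OF parts] ab(3) by simp
        then have aR: "a \<in> R" using S.m_closed[OF xR S.one_closed] by simp
        have "b = \<ominus> a \<oplus> x" unfolding ab(3) using r_neg1[OF carr] by simp
        then have "b \<in> R"
          using aR x subrng additive_subgroup.a_closed[of R U "\<ominus> a" x] additive_subgroup.a_inv_closed[of R U a]
            abelian_group_axioms by (simp add: lc_subrng_def)
        then have "a \<in> ?p0" "b \<in> ?p1" using q0(2) q1(2) ab parts aR by blast+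
        then have "x \<in> ?p0 <+>\<^bsub>U\<^esub> ?p1" unfolding ab(3) by (rule set_add_memI)
        then show "x \<in> p" by (rule subsetD[OF equalityD2[OF p_sum]])
      qed
    qed
    ultimately show ?thesis by blast
  qed
  show ?thesis
  proof (cases "R \<inter> halo U \<subseteq> p")
    case True
    have "primeideal ?p0 ((even_ring U)\<lparr>carrier := R \<inter> even_part U\<rparr>)" using p' by blast
    from even.lying_over[OF even_subring this even_integral[OF int]]
    obtain q0 where q0: "primeideal q0 (even_ring U)" "q0 \<inter> (R \<inter> even_part U) = ?p0" by blast
    show ?thesis
    proof (rule comp[OF q0])
      show "ideal (halo U) (halo_ring U)" using odd.oneideal by simp
      show "halo U \<inter> (R \<inter> halo U) = ?p1" using True pR by blast
      fix x assume "x \<in> q0"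
      then have "x \<in> even_part U"
        using ideal.Icarr[OF primeideal.axioms(1)[OF q0(1)]] by simp
      then show "x \<otimes> sharp_one U \<in> halo U"
        using mult_halo odd.one_closed unfolding even_part_iff by blast
    qed simp
  next
    case False
    then have p1: "primeideal ?p1 ((halo_ring U)\<lparr>carrier := R \<inter> halo U\<rparr>)"
      and p01: "\<And>x. x \<in> R \<inter> even_part U \<Longrightarrow> x \<otimes> sharp_one U \<in> p \<Longrightarrow> x \<in> p"
      using p' by auto
    from odd.lying_over[OF halo_subring p1 halo_integral[OF int]]
    obtain q1 where q1: "primeideal q1 (halo_ring U)" "q1 \<inter> (R \<inter> halo U) = ?p1" by blast
    \<comment> \<open>With \<open>q1\<close> prime, the characterization of Hu-Liu primes leaves
      only the preimage of \<open>q1\<close> under \<phi> as even part.\<close>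
    let ?q0 = "{x \<in> even_part U. x \<otimes> sharp_one U \<in> q1}"
    show ?thesis
    proof (rule comp)
      show "primeideal ?q0 (even_ring U)"
        using ring_hom_ring.primeideal_vimage[OF even_hom_ring even_cring q1(1)] by simp
      show "?q0 \<inter> (R \<inter> even_part U) = ?p0"
      proof -
        \<comment> \<open>For even \<open>x\<close> in \<open>R\<close>, \<phi>(x) stays in
          \<open>R\<close>, where membership in \<open>q1\<close> means membership in
          \<open>p\<close>. That in turn is equivalent to \<open>x \<in> p\<close>: one direction is
          absorption, the other is \<open>p01\<close>.\<close>
        have "x \<otimes> sharp_one U \<in> R \<inter> halo U" if "x \<in> R" for x
          using S.mult_halo[of x "sharp_one U"] that sharp_one_in_sub odd.one_closed sub_halo by simp
        moreover have "x \<otimes> sharp_one U \<in> p" if "x \<in> p" for x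
          using pi that sharp_one_in_sub by (simp add: lc_ideal_def)
        ultimately have "x \<otimes> sharp_one U \<in> q1 \<longleftrightarrow> x \<in> p" if "x \<in> R \<inter> even_part U" for x
          using that q1(2) p01 by blast
        then show ?thesis using pR by blast
      qed
      show "ideal q1 (halo_ring U)" using q1(1) by (rule primeideal.axioms)
    qed (use q1 in auto)
  qed
qed

end

theorem proposition2p1:
  fixes U :: "('a, 'm) lc_rng_scheme" and R p :: "'a set"
  assumes "left_commutative_rng U"
    and "lc_subrng R U"
    and "graded_integral R U"
    and "hu_liu_prime p (U\<lparr>carrier := R\<rparr>)"
  shows "\<exists>q. hu_liu_prime q U \<and> q \<inter> R = p"
  using left_commutative_subrng.hu_liu_lying_over[of U R p] assms
  by (simp add: left_commutative_subrng_def left_commutative_subrng_axioms_def)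

end
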